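(* Consider the MI-NEP of the context. Suppose that Assumption A (with constants $\alpha\in[0,1)$ and $\mathbf w\in\mathbb R^N$, $w_\nu>0$) and Assumption B (with constant $\beta>0$) hold, and that $\max_{\nu\in\mathcal I}\sqrt{i_\nu}>0$. Let $\{\mathbf x^k\}_{k\in\mathbb N}\subseteq X$ be the sequence generated by the Jacobi-type continuous best-response method with index sets $\{\mathcal J^k\}_{k\in\mathbb N}$, and assume that there is an integer $h\ge1$ such that every $h$ iterations at least one best response of any player is computed, that is, $\nu\in\bigcup_{t=k}^{k+h-1}\mathcal J^t$ for every player $\nu\in\mathcal I$ and every iteration $k$. Let $\mathcal S$ be the (possibly empty) set of equilibria of the MI-NEP. (i) For every $\gamma\in(1,1/\alpha)$ and every $\mathbf x^*\in\mathcal S$, the method generates a point $\mathbf x^k$ such that $$\max_{\nu\in\mathcal I} w_\nu\|x^{k,\nu}-x^{*,\nu}\| < \beta\left(\frac{\gamma}{1-\gamma\alpha}\right)\max_{\nu\in\mathcal I}w_\nu\sqrt{i_\nu}\qquad(\star)$$ after at most $\widetilde k_\gamma$ iterations, where $$\widetilde k_\gamma := h\left\lceil \log_\gamma\left(\max\left\{\frac{(1-\gamma\alpha)\max_{\mathbf z^*\in\mathcal S,\,\nu\in\mathcal I}w_\nu\|x^{0,\nu}-z^{*,\nu}\|}{\beta\max_{\nu\in\mathcal I}w_\nu\sqrt{i_\nu}},\ \gamma\right\}\right)\right\rceil .$$ (ii) For every $\gamma\in(1,1/\alpha)$ and every $\mathbf x^*\in\mathcal S$, any point $\mathbf x^k$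 with $k\ge\widetilde k_\gamma$ satisfies $(\star)$. (iii) The sequence $\{\mathbf x^k\}_{k\in\mathbb N}$ converges to a unique point $\overline{\mathbf x}\in X$, and for every $\mathbf x^*\in\mathcal S$, $$\max_{\nu\in\mathcal I}w_\nu\|\overline x^\nu-x^{*,\nu}\|\le \beta\left(\frac{1}{1-\alpha}\right)\max_{\nu\in\mathcal I}w_\nu\sqrt{i_\nu}.$$
   Context: MI-NEP (mixed-integer Nash equilibrium problem). There are $N$ players, $\mathcal I=\{1,\dots,N\}$. Player $\nu$ controls $x^\nu\in\mathbb R^{n_\nu}$; $\mathbf x=(x^\nu)_{\nu\in\mathcal I}\in\mathbb R^n$, $n=\sum_\nu n_\nu$; $\mathbf x^{-\nu}$ collects the strategies of all players other than $\nu$, and one writes $\mathbf x=(x^\nu,\mathbf x^{-\nu})$. Given $\mathbf x^{-\nu}$, player $\nu$ solves $$\min_{x^\nu}\ \theta_\nu(x^\nu,\mathbf x^{-\nu})\quad\text{s.t. } x^\nu\in\Omega_\nu:=\{x^\nu\in X_\nu \mid x^\nu_j\in\mathbb Z,\ j=1,\dots,i_\nu\},$$ where $\theta_\nu:\mathbb R^n\to\mathbb R$ is continuously differentiable and convex with respect to $x^\nu$, $X_\nu\subseteq\mathbb R^{n_\nu}$ is closed and convex (possibly unbounded), $0\le i_\nu\le n_\nu$ is an integer, and $\Omega_\nu\neq\emptyset$. Put $\Omega=\prod_\nu\Omega_\nu$, $X=\prod_\nu X_\nu$, $\Omega_{-\nu}=\prod_{\nu'\ne\nu}\Omega_{\nu'}$.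 Standing assumption: each player's problem has a solution for every given $\mathbf x^{-\nu}$. Best responses: $R_\nu(\mathbf x^{-\nu})=\arg\min\{\theta_\nu(x^\nu,\mathbf x^{-\nu}) : x^\nu\in\Omega_\nu\}$ (mixed-integer) and $T_\nu(\mathbf x^{-\nu})=\arg\min\{\theta_\nu(x^\nu,\mathbf x^{-\nu}) : x^\nu\in X_\nu\}$ (continuous). It is assumed throughout that $T=(T_\nu)_\nu$ is single-valued on $X$. Equilibrium of the MI-NEP: $\overline{\mathbf x}\in\Omega$ such that $\overline x^\nu\in R_\nu(\overline{\mathbf x}^{-\nu})$ for all $\nu\in\mathcal I$. $\|\cdot\|$ is any given norm. Assumption A: there exist $\alpha\in[0,1)$ and $\mathbf w\in\mathbb R^N$ with $w_\nu>0$ for all $\nu$ such that for all $\mathbf z,\mathbf y\in X$: $\max_{\nu}w_\nu\|T_\nu(\mathbf z^{-\nu})-T_\nu(\mathbf y^{-\nu})\|\le\alpha\max_\nu w_\nu\|z^\nu-y^\nu\|$. Assumption B: there exists $\beta>0$ such that for all $\nu\in\mathcal I$ and $\mathbf z^{-\nu}\in\Omega_{-\nu}$: $\|\widehat x^\nu-T_\nu(\mathbf z^{-\nu})\|\le\beta\sqrt{i_\nu}$ for all $\widehat x^\nu\in R_\nu(\mathbf z^{-\nu})$. Jacobi-type continuous best-response method: start from $\mathbf x^0\in X$; at each iteration $k=0,1,\dots$ select a subset $\mathcal J^k\subseteq\mathcal I$; for $\nu\in\mathcal J^k$ set $x^{k+1,\nu}=T_\nu(\mathbf x^{k,-\nu})$;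 for $\nu\notin\mathcal J^k$ set $x^{k+1,\nu}=x^{k,\nu}$. Convention: $1/\alpha=+\infty$ if $\alpha=0$. Items (i) and (ii) are vacuous when $\mathcal S=\emptyset$. *)

theory Defs
  imports "HOL-Analysis.Analysis"
begin

text \<open>
  The players are the elements of a finite type \<open>'p\<close> and the joint space $R^n$ is \<open>real ^ 'c\<close>.
  Since the dimensions of the players' spaces differ, $x^\nu$ is identified with the vector of the
  joint space that has the entries of $x^\nu$ at the coordinates of player \<open>\<nu>\<close> and is zero elsewhere:
  the \<open>j\<close>-th variable of \<open>\<nu>\<close> (\<open>j < nvar \<nu>\<close>, counted from 0) sits at the coordinate \<open>coord \<nu> j\<close>.
\<close>

record ('p, 'c::finite) game =
  nvar :: "'p \<Rightarrow> nat"
  nint :: "'p \<Rightarrow> nat"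
  coord :: "'p \<Rightarrow> nat \<Rightarrow> 'c"
  cost :: "'p \<Rightarrow> real ^ 'c \<Rightarrow> real"
  strat :: "'p \<Rightarrow> (real ^ 'c) set"

definition coords :: "('p, 'c::finite) game \<Rightarrow> 'p \<Rightarrow> 'c set" where
  "coords G \<nu> = coord G \<nu> ` {..<nvar G \<nu>}"

definition pspace :: "('p, 'c::finite) game \<Rightarrow> 'p \<Rightarrow> (real ^ 'c) set" where
  "pspace G \<nu> = {v. \<forall>c. c \<notin> coords G \<nu> \<longrightarrow> v $ c = 0}"

definition block :: "('p, 'c::finite) game \<Rightarrow> 'p \<Rightarrow> real ^ 'c \<Rightarrow> real ^ 'c" where
  "block G \<nu> x = (\<chi> c. if c \<in> coords G \<nu> then x $ c else 0)"

text \<open>The profile $(y^\nu, x^{-\nu})$; it does not depend on the block of \<open>x\<close> belonging to \<open>\<nu>\<close>.\<close>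

definition replace :: "('p, 'c::finite) game \<Rightarrow> 'p \<Rightarrow> real ^ 'c \<Rightarrow> real ^ 'c \<Rightarrow> real ^ 'c" where
  "replace G \<nu> y x = (\<chi> c. if c \<in> coords G \<nu> then y $ c else x $ c)"

definition mistrat :: "('p, 'c::finite) game \<Rightarrow> 'p \<Rightarrow> (real ^ 'c) set" where
  "mistrat G \<nu> = {v \<in> strat G \<nu>. \<forall>j<nint G \<nu>. v $ coord G \<nu> j \<in> \<int>}"

definition profiles :: "('p, 'c::finite) game \<Rightarrow> (real ^ 'c) set" where
  "profiles G = {x. \<forall>\<nu>. block G \<nu> x \<in> strat G \<nu>}"

definition miprofiles :: "('p, 'c::finite) game \<Rightarrow> (real ^ 'c) set" where
  "miprofiles G = {x. \<forall>\<nu>. block G \<nu> x \<in> mistrat G \<nu>}"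

text \<open>The best-response sets $R_\nu(x^{-\nu})$ (mixed-integer) and $T_\nu(x^{-\nu})$ (continuous).\<close>

definition mi_best :: "('p, 'c::finite) game \<Rightarrow> 'p \<Rightarrow> real ^ 'c \<Rightarrow> (real ^ 'c) set" where
  "mi_best G \<nu> x =
     {y. is_arg_min (\<lambda>v. cost G \<nu> (replace G \<nu> v x)) (\<lambda>v. v \<in> mistrat G \<nu>) y}"

definition cont_best :: "('p, 'c::finite) game \<Rightarrow> 'p \<Rightarrow> real ^ 'c \<Rightarrow> (real ^ 'c) set" where
  "cont_best G \<nu> x =
     {y. is_arg_min (\<lambda>v. cost G \<nu> (replace G \<nu> v x)) (\<lambda>v. v \<in> strat G \<nu>) y}"

definition single_valued_cont_best :: "('p, 'c::finite) game \<Rightarrow> bool" where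
  "single_valued_cont_best G \<longleftrightarrow> (\<forall>x\<in>profiles G. \<forall>\<nu>. \<exists>!y. y \<in> cont_best G \<nu> x)"

text \<open>$T_\nu$ as a function, meaningful where the best-response set is a singleton.\<close>

definition Tmap :: "('p, 'c::finite) game \<Rightarrow> 'p \<Rightarrow> real ^ 'c \<Rightarrow> real ^ 'c" where
  "Tmap G \<nu> x = the_elem (cont_best G \<nu> x)"

definition equilibria :: "('p, 'c::finite) game \<Rightarrow> (real ^ 'c) set" where
  "equilibria G = {x \<in> miprofiles G. \<forall>\<nu>. block G \<nu> x \<in> mi_best G \<nu> x}"

definition continuously_differentiable :: "('a::real_inner \<Rightarrow> real) \<Rightarrow> bool" where
  "continuously_differentiable f \<longleftrightarrow> (\<exists>g. (\<forall>x. GDERIV f x :> g x) \<and> continuous_on UNIV g)"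

definition mi_nep :: "('p::finite, 'c::finite) game \<Rightarrow> bool" where
  "mi_nep G \<longleftrightarrow>
     bij_betw (\<lambda>(\<nu>, j). coord G \<nu> j) (SIGMA \<nu>:UNIV. {..<nvar G \<nu>}) UNIV \<and>
     (\<forall>\<nu>. nint G \<nu> \<le> nvar G \<nu> \<and>
          continuously_differentiable (cost G \<nu>) \<and>
          (\<forall>x. convex_on (pspace G \<nu>) (\<lambda>v. cost G \<nu> (replace G \<nu> v x))) \<and>
          strat G \<nu> \<subseteq> pspace G \<nu> \<and> closed (strat G \<nu>) \<and> convex (strat G \<nu>) \<and>
          mistrat G \<nu> \<noteq> {} \<and>
          (\<forall>x. mi_best G \<nu> x \<noteq> {}))"

definition is_norm_on :: "'a::real_vector set \<Rightarrow> ('a \<Rightarrow> real) \<Rightarrow> bool" where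
  "is_norm_on V f \<longleftrightarrow>
     (\<forall>u\<in>V. 0 \<le> f u \<and> (f u = 0 \<longleftrightarrow> u = 0)) \<and>
     (\<forall>u\<in>V. \<forall>a. f (a *\<^sub>R u) = \<bar>a\<bar> * f u) \<and>
     (\<forall>u\<in>V. \<forall>v\<in>V. f (u + v) \<le> f u + f v)"

definition assumption_A ::
  "('p::finite, 'c::finite) game \<Rightarrow> ('p \<Rightarrow> real ^ 'c \<Rightarrow> real) \<Rightarrow> real \<Rightarrow> ('p \<Rightarrow> real) \<Rightarrow> bool" where
  "assumption_A G nrm \<alpha> w \<longleftrightarrow>
     0 \<le> \<alpha> \<and> \<alpha> < 1 \<and> (\<forall>\<nu>. 0 < w \<nu>) \<and>
     (\<forall>z\<in>profiles G. \<forall>y\<in>profiles G.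
        (MAX \<nu>. w \<nu> * nrm \<nu> (Tmap G \<nu> z - Tmap G \<nu> y))
          \<le> \<alpha> * (MAX \<nu>. w \<nu> * nrm \<nu> (block G \<nu> z - block G \<nu> y)))"

text \<open>Only the blocks of \<open>z\<close> belonging to the opponents of \<open>\<nu>\<close> are constrained, since
  $z^{-\nu}$ ranges over $\Omega_{-\nu}$.\<close>

definition assumption_B ::
  "('p::finite, 'c::finite) game \<Rightarrow> ('p \<Rightarrow> real ^ 'c \<Rightarrow> real) \<Rightarrow> real \<Rightarrow> bool" where
  "assumption_B G nrm \<beta> \<longleftrightarrow>
     0 < \<beta> \<and>
     (\<forall>\<nu> z. (\<forall>\<mu>. \<mu> \<noteq> \<nu> \<longrightarrow> block G \<mu> z \<in> mistrat G \<mu>) \<longrightarrow>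
        (\<forall>xh\<in>mi_best G \<nu> z. nrm \<nu> (xh - Tmap G \<nu> z) \<le> \<beta> * sqrt (nint G \<nu>)))"

definition jacobi_sequence ::
  "('p, 'c::finite) game \<Rightarrow> (nat \<Rightarrow> 'p set) \<Rightarrow> (nat \<Rightarrow> real ^ 'c) \<Rightarrow> bool" where
  "jacobi_sequence G J x \<longleftrightarrow>
     x 0 \<in> profiles G \<and>
     (\<forall>k \<nu>. block G \<nu> (x (Suc k)) = (if \<nu> \<in> J k then Tmap G \<nu> (x k) else block G \<nu> (x k)))"

text \<open>
  The maximum over equilibria is written as a supremum because there may be infinitely many
  equilibria; under the assumptions they form a compact set, so for a nonempty set of equilibria
  the supremum is attained. The logarithm is at least 1, so \<open>nat\<close> loses nothing.
\<close>

definition iteration_bound ::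
  "('p::finite, 'c::finite) game \<Rightarrow> ('p \<Rightarrow> real ^ 'c \<Rightarrow> real) \<Rightarrow> real \<Rightarrow> ('p \<Rightarrow> real) \<Rightarrow> real \<Rightarrow>
     nat \<Rightarrow> real ^ 'c \<Rightarrow> real \<Rightarrow> nat" where
  "iteration_bound G nrm \<alpha> w \<beta> h x0 \<gamma> =
     h * nat \<lceil>log \<gamma> (max
       ((1 - \<gamma> * \<alpha>) *
          (SUP (z, \<nu>) \<in> equilibria G \<times> UNIV. w \<nu> * nrm \<nu> (block G \<nu> x0 - block G \<nu> z)) /
        (\<beta> * (MAX \<nu>. w \<nu> * sqrt (nint G \<nu>))))
       \<gamma>)\<rceil>"

end

theory Submission
  imports Defs
begin

text \<open>
  In the weighted maximum norm the joint best-response map is an \<open>\<alpha>\<close>-contraction, and by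
  Assumption B it moves every equilibrium by at most $b = \beta \max_\nu w_\nu \sqrt{i_\nu}$.
  Hence the distance to an equilibrium obeys \<open>M \<mapsto> \<alpha> * M + b\<close> over each window of \<open>h\<close>
  iterations. With $C = b / (1 - \gamma\alpha)$ this map sends $\gamma^{i+1} C$ below $\gamma^i C$,
  so \<open>m\<close> windows bring an initial distance of at most $\gamma^m C$ down to \<open>C\<close>, which is
  strictly below $\gamma C$. For convergence the same recursion, with \<open>b = 0\<close>, is applied to the
  fixed point of the contraction.
\<close>

section \<open>Equivalence of an arbitrary norm with the Euclidean norm\<close>

text \<open>Expansion in the basis gives the upper bound, which makes \<open>f\<close> Lipschitz; so
  \<open>f\<close> attains a positive minimum on the compact unit sphere, and rescaling turns it
  into the lower bound.\<close>

lemma norm_on_UNIV_equivalent: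
  fixes f :: "'a::euclidean_space \<Rightarrow> real"
  assumes "is_norm_on UNIV f"
  obtains K L where "0 < K" "0 < L" "\<And>v. norm v \<le> K * f v" "\<And>v. f v \<le> L * norm v"
proof -
  have nonneg: "0 \<le> f u" and zero: "f u = 0 \<longleftrightarrow> u = 0"
    and scale: "f (a *\<^sub>R u) = \<bar>a\<bar> * f u" and tri: "f (u + v) \<le> f u + f v" for u v a
    using assms by (auto simp: is_norm_on_def)
  have sum_le: "f (sum g A) \<le> (\<Sum>i\<in>A. f (g i))" if "finite A" for g :: "'a \<Rightarrow> 'a" and A
    using that
  proof (induction A rule: finite_induct)
    case empty
    show ?case using zero[of 0] by simp
  next
    case (insert i A)
    then show ?case using tri[of "g i" "sum g A"] by simp
  qed
  \<comment> \<open>The added 1 makes \<open>0 < L\<close> follow from nonnegativity of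
    \<open>f\<close> alone.\<close>
  define L where "L = (\<Sum>i\<in>Basis. f i) + 1"
  have L: "0 < L" using sum_nonneg[of Basis f] nonneg by (simp add: L_def add_nonneg_pos)
  have upper: "f v \<le> L * norm v" for v
  proof -
    have "f v = f (\<Sum>i\<in>Basis. (v \<bullet> i) *\<^sub>R i)" by (simp add: euclidean_representation)
    also have "\<dots> \<le> (\<Sum>i\<in>Basis. \<bar>v \<bullet> i\<bar> * f i)"
      using sum_le[of Basis "\<lambda>i. (v \<bullet> i) *\<^sub>R i"] by (simp add: scale)
    also have "\<dots> \<le> (\<Sum>i\<in>Basis. norm v * f i)"
      by (intro sum_mono mult_right_mono Basis_le_norm nonneg)
    also have "\<dots> \<le> L * norm v" by (simp add: L_def sum_distrib_left algebra_simps)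
    finally show ?thesis .
  qed
  have lip: "\<bar>f u - f v\<bar> \<le> L * norm (u - v)" for u v
  proof -
    have "f (v - u) = f (u - v)" using scale[of "-1" "u - v"] by simp
    then show ?thesis using tri[of "u - v" v] tri[of "v - u" u] upper[of "u - v"] by simp
  qed
  have "continuous_on (sphere 0 1) f"
    by (rule lipschitz_on_continuous_on[of L], rule lipschitz_onI)
      (use lip L in \<open>auto simp: dist_norm\<close>)
  moreover have "sphere (0::'a) 1 \<noteq> {}" by simp
  ultimately obtain u where u: "u \<in> sphere 0 1" and umin: "\<And>v. v \<in> sphere 0 1 \<Longrightarrow> f u \<le> f v"
    using continuous_attains_inf[of "sphere (0::'a) 1" f] by auto
  have fu: "0 < f u" using u zero[of u] nonneg[of u] by (cases "u = 0") auto
  have "norm v \<le> 1 / f u * f v" for v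
  proof (cases "v = 0")
    case True
    then show ?thesis using zero[of v] by simp
  next
    case False
    then have "f u \<le> f (inverse (norm v) *\<^sub>R v)" by (intro umin) simp
    then show ?thesis using False fu by (simp add: scale field_simps)
  qed
  then show ?thesis using that[of "1 / f u" L] fu L upper by simp
qed

section \<open>Error recursion under partial updates\<close>

text \<open>Here \<open>d k \<nu>\<close> stands for the weighted error of player
  \<open>\<nu>\<close> at iteration \<open>k\<close>. Each player updates at some time in the window
  starting at \<open>k0\<close>; afterwards a further update reproduces the bound and an idle step
  preserves the error.\<close>

lemma windowed_contraction:
  fixes d :: "nat \<Rightarrow> 'p \<Rightarrow> real"
  assumes active: "\<And>k \<nu> M. \<lbrakk>\<nu> \<in> J k; \<And>\<mu>. d k \<mu> \<le> M\<rbrakk> \<Longrightarrow> d (Suc k) \<nu> \<le> \<alpha> * M + b"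
    and idle: "\<And>k \<nu>. \<nu> \<notin> J k \<Longrightarrow> d (Suc k) \<nu> = d k \<nu>"
    and cover: "\<And>k \<nu>. \<nu> \<in> (\<Union>t\<in>{k..k + h - 1}. J t)" and "1 \<le> h"
    and le: "\<alpha> * M + b \<le> M"
    and start: "\<And>k \<nu>. k0 \<le> k \<Longrightarrow> d k \<nu> \<le> M"
    and "k0 + h \<le> k"
  shows "d k \<nu> \<le> \<alpha> * M + b"
proof -
  obtain t where t: "k0 \<le> t" "t \<le> k0 + h - 1" "\<nu> \<in> J t" using cover[of \<nu> k0] by auto
  \<comment> \<open>The effect of an update at \<open>t\<close> shows at \<open>Suc t\<close>, which
    by \<open>1 \<le> h\<close> is at most \<open>k0 + h\<close>.\<close>
  have "Suc t \<le> k" using t \<open>1 \<le> h\<close> \<open>k0 + h \<le> k\<close> by simp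
  then show ?thesis
  proof (induction k rule: dec_induct)
    case base
    show ?case using active[of \<nu> t M] t start by blast
  next
    case (step n)
    then have "k0 \<le> n" using t(1) by simp
    then show ?case
      using active[of \<nu> n M] idle[of \<nu> n] start[of n] step.IH by (cases "\<nu> \<in> J n") auto
  qed
qed

text \<open>An update cannot exceed a level that the recursion does not raise. This starts the
  induction over windows, before any update is guaranteed.\<close>

lemma invariant_bound:
  fixes d :: "nat \<Rightarrow> 'p \<Rightarrow> real"
  assumes active: "\<And>k \<nu> M. \<lbrakk>\<nu> \<in> J k; \<And>\<mu>. d k \<mu> \<le> M\<rbrakk> \<Longrightarrow> d (Suc k) \<nu> \<le> \<alpha> * M + b"
    and idle: "\<And>k \<nu>. \<nu> \<notin> J k \<Longrightarrow> d (Suc k) \<nu> = d k \<nu>"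
    and le: "\<alpha> * M + b \<le> M"
    and start: "\<And>\<nu>. d 0 \<nu> \<le> M"
  shows "d k \<nu> \<le> M"
proof (induction k arbitrary: \<nu>)
  case 0
  show ?case by (rule start)
next
  case (Suc k)
  then show ?case using active[of \<nu> k M] idle[of \<nu> k] le by (cases "\<nu> \<in> J k") force+
qed

text \<open>\<open>M i\<close> is the level valid from iteration \<open>h * i\<close> on; one more
  window brings it to \<open>\<alpha> * M i + b\<close>, hence to at most \<open>M (Suc i)\<close>.
  The conditions on \<open>M\<close> stop at \<open>m\<close>, so levels may be designed for a fixed
  number of windows.\<close>

lemma iterated_windowed_contraction:
  fixes d :: "nat \<Rightarrow> 'p \<Rightarrow> real" and M :: "nat \<Rightarrow> real"
  assumes active: "\<And>k \<nu> M. \<lbrakk>\<nu> \<in> J k; \<And>\<mu>. d k \<mu> \<le> M\<rbrakk> \<Longrightarrow> d (Suc k) \<nu> \<le> \<alpha> * M + b"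
    and idle: "\<And>k \<nu>. \<nu> \<notin> J k \<Longrightarrow> d (Suc k) \<nu> = d k \<nu>"
    and cover: "\<And>k \<nu>. \<nu> \<in> (\<Union>t\<in>{k..k + h - 1}. J t)" and "1 \<le> h"
    and start: "\<And>\<nu>. d 0 \<nu> \<le> M 0"
    and next_le: "\<And>i. i < m \<Longrightarrow> \<alpha> * M i + b \<le> M (Suc i)"
    and le: "\<And>i. i \<le> m \<Longrightarrow> \<alpha> * M i + b \<le> M i"
    and "i \<le> m" "h * i \<le> k"
  shows "d k \<nu> \<le> M i"
  using \<open>i \<le> m\<close> \<open>h * i \<le> k\<close>
proof (induction i arbitrary: k \<nu>)
  case 0
  show ?case by (rule invariant_bound[where d = d and \<alpha> = \<alpha> and b = b and M = "M 0" and J = J,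
          OF active idle le start]) simp_all
next
  case (Suc i)
  have "d k \<nu> \<le> \<alpha> * M i + b"
    by (rule windowed_contraction[where d = d and \<alpha> = \<alpha> and b = b and M = "M i" and J = J
          and h = h and ?k0.0 = "h * i", OF active idle cover \<open>1 \<le> h\<close> le]) (use Suc in auto)
  then show ?case using next_le[of i] Suc.prems by simp
qed

section \<open>Weighted maximum norm and blocks of the joint space\<close>

text \<open>At a difference, this is the maximum that Assumption A and the error bounds speak
  of.\<close>

definition wnorm ::
  "('p::finite, 'c::finite) game \<Rightarrow> ('p \<Rightarrow> real ^ 'c \<Rightarrow> real) \<Rightarrow> ('p \<Rightarrow> real) \<Rightarrow> real ^ 'c \<Rightarrow> real" where
  "wnorm G nrm w v = (MAX \<nu>. w \<nu> * nrm \<nu> (block G \<nu> v))"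

text \<open>For a profile of a game with single-valued best responses, the summands live on disjoint
  coordinate sets, so the sum glues them into one vector.\<close>

definition Tjoint :: "('p::finite, 'c::finite) game \<Rightarrow> real ^ 'c \<Rightarrow> real ^ 'c" where
  "Tjoint G x = (\<Sum>\<nu>\<in>UNIV. Tmap G \<nu> x)"

lemma block_add: "block G \<nu> (x + y) = block G \<nu> x + block G \<nu> y"
  by (simp add: block_def vec_eq_iff)

lemma block_scaleR: "block G \<nu> (a *\<^sub>R x) = a *\<^sub>R block G \<nu> x"
  by (simp add: block_def vec_eq_iff)

lemma linear_block: "linear (block G \<nu>)"
  by (rule linearI) (simp_all add: block_add block_scaleR)

lemma block_in_pspace: "block G \<nu> x \<in> pspace G \<nu>"
  by (simp add: block_def pspace_def)

lemma block_diff: "block G \<nu> (x - y) = block G \<nu> x - block G \<nu> y"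
  by (simp add: linear_diff linear_block)

locale game_coordinates =
  fixes G :: "('p::finite, 'c::finite) game"
  assumes bij: "bij_betw (\<lambda>(\<nu>, j). coord G \<nu> j) (SIGMA \<nu>:UNIV. {..<nvar G \<nu>}) UNIV"
begin

lemma coords_cover: obtains \<nu> where "c \<in> coords G \<nu>"
proof -
  have "c \<in> (\<lambda>(\<nu>, j). coord G \<nu> j) ` (SIGMA \<nu>:UNIV. {..<nvar G \<nu>})"
    using bij by (simp add: bij_betw_def)
  then show thesis using that by (auto simp: coords_def)
qed

lemma coords_disjoint:
  assumes "c \<in> coords G \<nu>" "c \<in> coords G \<mu>"
  shows "\<nu> = \<mu>"
proof -
  obtain i j where "i < nvar G \<nu>" "j < nvar G \<mu>" "coord G \<nu> i = c" "coord G \<mu> j = c"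
    using assms by (auto simp: coords_def)
  then show ?thesis
    using bij inj_onD[of "\<lambda>(\<nu>, j). coord G \<nu> j" _ "(\<nu>, i)" "(\<mu>, j)"]
    by (auto simp: bij_betw_def)
qed

lemma block_ext:
  assumes "\<And>\<nu>. block G \<nu> x = block G \<nu> y"
  shows "x = y"
proof (simp add: vec_eq_iff, rule)
  fix c
  obtain \<nu> where "c \<in> coords G \<nu>" by (rule coords_cover)
  then show "x $ c = y $ c"
    using arg_cong[OF assms[of \<nu>], of "\<lambda>v. v $ c"] by (simp add: block_def)
qed

lemma block_sum:
  assumes "\<And>\<mu>. v \<mu> \<in> pspace G \<mu>"
  shows "block G \<nu> (\<Sum>\<mu>\<in>UNIV. v \<mu>) = v \<nu>"
proof -
  have "block G \<nu> (v \<mu>) = (if \<mu> = \<nu> then v \<nu> else 0)" for \<mu>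
    using assms[of \<mu>] coords_disjoint[of _ \<nu> \<mu>] by (auto simp: block_def pspace_def vec_eq_iff)
  then show ?thesis by (simp add: linear_sum[OF linear_block])
qed

text \<open>Definiteness holds because the blocks determine a vector; homogeneity, because
  multiplication by \<open>\<bar>a\<bar>\<close> is monotone and so commutes with the finite
  maximum.\<close>

lemma is_norm_on_wnorm:
  assumes nrm: "\<And>\<nu>. is_norm_on (pspace G \<nu>) (nrm \<nu>)" and w: "\<And>\<nu>. 0 < w \<nu>"
  shows "is_norm_on UNIV (wnorm G nrm w)"
proof -
  have nonneg: "0 \<le> w \<nu> * nrm \<nu> (block G \<nu> u)"
    and zero: "nrm \<nu> (block G \<nu> u) = 0 \<longleftrightarrow> block G \<nu> u = 0"
    and scale: "nrm \<nu> (block G \<nu> (a *\<^sub>R u)) = \<bar>a\<bar> * nrm \<nu> (block G \<nu> u)"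
    and tri: "nrm \<nu> (block G \<nu> (u + v)) \<le> nrm \<nu> (block G \<nu> u) + nrm \<nu> (block G \<nu> v)" for u v a \<nu>
    using nrm[of \<nu>] w[of \<nu>] block_in_pspace[of G \<nu>]
    by (auto simp: is_norm_on_def block_add block_scaleR)
  have le: "w \<nu> * nrm \<nu> (block G \<nu> u) \<le> wnorm G nrm w u" for u \<nu>
    by (simp add: wnorm_def)
  have max_le: "wnorm G nrm w u \<le> M \<longleftrightarrow> (\<forall>\<nu>. w \<nu> * nrm \<nu> (block G \<nu> u) \<le> M)" for u M
    by (simp add: wnorm_def)
  have wn_nonneg: "0 \<le> wnorm G nrm w u" for u using nonneg le order_trans by blast
  have block0: "block G \<nu> 0 = 0" for \<nu> by (simp add: linear_0 linear_block)
  have "wnorm G nrm w u = 0 \<longleftrightarrow> u = 0" for u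
  proof
    assume "wnorm G nrm w u = 0"
    then have "w \<nu> * nrm \<nu> (block G \<nu> u) = 0" for \<nu>
      using le[of \<nu> u] nonneg[of \<nu> u] by simp
    then have "block G \<nu> u = block G \<nu> 0" for \<nu>
      using zero[of \<nu> u] w[of \<nu>] block0[of \<nu>] by (metis less_irrefl mult_eq_0_iff)
    then show "u = 0" by (rule block_ext)
  next
    assume "u = 0"
    then have "nrm \<nu> (block G \<nu> u) = 0" for \<nu> using zero[of \<nu> u] block0[of \<nu>] by simp
    then show "wnorm G nrm w u = 0" by (simp add: wnorm_def)
  qed
  moreover have "wnorm G nrm w (u + v) \<le> wnorm G nrm w u + wnorm G nrm w v" for u v
    unfolding max_le
  proof
    fix \<nu>
    have "w \<nu> * nrm \<nu> (block G \<nu> (u + v))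
        \<le> w \<nu> * nrm \<nu> (block G \<nu> u) + w \<nu> * nrm \<nu> (block G \<nu> v)"
      using mult_left_mono[OF tri[of \<nu> u v], of "w \<nu>"] w[of \<nu>] by (simp add: algebra_simps)
    then show "w \<nu> * nrm \<nu> (block G \<nu> (u + v)) \<le> wnorm G nrm w u + wnorm G nrm w v"
      using le[of \<nu> u] le[of \<nu> v] by linarith
  qed
  moreover have "wnorm G nrm w (a *\<^sub>R u) = \<bar>a\<bar> * wnorm G nrm w u" for a u
  proof -
    have "mono (\<lambda>t. \<bar>a\<bar> * t)" by (simp add: mono_def mult_left_mono)
    from mono_Max_commute[OF this, of "range (\<lambda>\<nu>. w \<nu> * nrm \<nu> (block G \<nu> u))"]
    show ?thesis by (simp add: wnorm_def scale image_image mult.left_commute)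
  qed
  ultimately show ?thesis using wn_nonneg by (simp add: is_norm_on_def)
qed

end

section \<open>Contraction and distances to equilibria\<close>

locale contractive_mi_nep =
  fixes G :: "('p::finite, 'c::finite) game"
    and nrm :: "'p \<Rightarrow> real ^ 'c \<Rightarrow> real"
    and \<alpha> \<beta> :: real and w :: "'p \<Rightarrow> real"
  assumes nep: "mi_nep G"
    and single_valued: "single_valued_cont_best G"
    and nrm: "\<And>\<nu>. is_norm_on (pspace G \<nu>) (nrm \<nu>)"
    and A: "assumption_A G nrm \<alpha> w"
    and B: "assumption_B G nrm \<beta>"
begin

sublocale game_coordinates G
  using nep by unfold_locales (simp add: mi_nep_def)

abbreviation "D \<equiv> wnorm G nrm w"

definition "b = \<beta> * (MAX \<nu>. w \<nu> * sqrt (nint G \<nu>))"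

lemma alpha: "0 \<le> \<alpha>" "\<alpha> < 1" and w_pos: "0 < w \<nu>" and beta: "0 < \<beta>"
  using A B by (simp_all add: assumption_A_def assumption_B_def)

lemma D_norm: "is_norm_on UNIV D"
  by (rule is_norm_on_wnorm[OF nrm w_pos])

lemma D_nonneg: "0 \<le> D u" and D_triangle: "D (u + v) \<le> D u + D v"
  using D_norm by (auto simp: is_norm_on_def)

lemma D_minus_commute: "D (u - v) = D (v - u)"
proof -
  have "D ((-1) *\<^sub>R (u - v)) = \<bar>-1\<bar> * D (u - v)"
    using D_norm unfolding is_norm_on_def by blast
  then show ?thesis by simp
qed

lemma D_triangle_diff: "D (u - v) \<le> D (u - z) + D (z - v)"
  using D_triangle[of "u - z" "z - v"] by (simp only: diff_add_cancel add_diff_eq)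

lemma component_le_D: "w \<nu> * nrm \<nu> (block G \<nu> u) \<le> D u"
  by (simp add: wnorm_def)

lemma D_le_iff: "D u \<le> M \<longleftrightarrow> (\<forall>\<nu>. w \<nu> * nrm \<nu> (block G \<nu> u) \<le> M)"
  by (simp add: wnorm_def)

lemma D_diff: "D (u - v) = (MAX \<nu>. w \<nu> * nrm \<nu> (block G \<nu> u - block G \<nu> v))"
  by (simp add: wnorm_def block_diff)

text \<open>Single-valuedness makes \<open>the_elem\<close> pick an actual minimizer.\<close>

lemma Tmap_in_strat:
  assumes "x \<in> profiles G"
  shows "Tmap G \<nu> x \<in> strat G \<nu>"
proof -
  have "\<exists>!y. y \<in> cont_best G \<nu> x"
    using single_valued assms by (simp add: single_valued_cont_best_def)
  then obtain y where "cont_best G \<nu> x = {y}" by blast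
  moreover from this have "y \<in> strat G \<nu>"
    by (auto simp: cont_best_def is_arg_min_def)
  ultimately show ?thesis by (simp add: Tmap_def)
qed

lemma block_Tjoint:
  assumes "x \<in> profiles G"
  shows "block G \<nu> (Tjoint G x) = Tmap G \<nu> x"
  unfolding Tjoint_def
  by (rule block_sum) (use Tmap_in_strat[OF assms] nep in \<open>auto simp: mi_nep_def\<close>)

lemma Tjoint_in_profiles: "x \<in> profiles G \<Longrightarrow> Tjoint G x \<in> profiles G"
  by (simp add: block_Tjoint profiles_def[of G] Tmap_in_strat)

lemma Tjoint_contraction:
  assumes "z \<in> profiles G" "y \<in> profiles G"
  shows "D (Tjoint G z - Tjoint G y) \<le> \<alpha> * D (z - y)"
  using A assms by (simp add: D_diff block_Tjoint assumption_A_def)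

lemma equilibria_subset_profiles: "equilibria G \<subseteq> profiles G"
  by (auto simp: equilibria_def miprofiles_def profiles_def mistrat_def)

text \<open>Each block of an equilibrium is a mixed-integer best response to the opponents, so
  Assumption B bounds its distance to the continuous one.\<close>

lemma equilibrium_displacement:
  assumes "xs \<in> equilibria G"
  shows "D (Tjoint G xs - xs) \<le> b"
proof -
  have "w \<nu> * nrm \<nu> (block G \<nu> (xs - Tjoint G xs)) \<le> b" for \<nu>
  proof -
    have "nrm \<nu> (block G \<nu> xs - Tmap G \<nu> xs) \<le> \<beta> * sqrt (nint G \<nu>)"
      using B assms by (auto simp: assumption_B_def equilibria_def miprofiles_def)
    then have "w \<nu> * nrm \<nu> (block G \<nu> xs - Tmap G \<nu> xs) \<le> \<beta> * (w \<nu> * sqrt (nint G \<nu>))"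
      using mult_left_mono[of "nrm \<nu> (block G \<nu> xs - Tmap G \<nu> xs)" "\<beta> * sqrt (nint G \<nu>)" "w \<nu>"]
        w_pos[of \<nu>] by (simp add: mult_ac)
    also have "\<dots> \<le> b"
      unfolding b_def using beta by (intro mult_left_mono Max_ge) auto
    finally show ?thesis
      using assms equilibria_subset_profiles by (simp add: block_diff block_Tjoint subset_iff)
  qed
  then have "D (xs - Tjoint G xs) \<le> b" by (simp add: D_le_iff)
  then show ?thesis by (simp only: D_minus_commute[of xs])
qed

text \<open>Triangle inequality through \<open>Tjoint G xs\<close>: contraction controls the first
  part, displacement the second.\<close>

lemma equilibrium_distance:
  assumes "x \<in> profiles G" "xs \<in> equilibria G"
  shows "D (Tjoint G x - xs) \<le> \<alpha> * D (x - xs) + b"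
  using D_triangle_diff[of "Tjoint G x" xs "Tjoint G xs"] Tjoint_contraction[of x xs]
    equilibrium_displacement[of xs] assms equilibria_subset_profiles by auto

text \<open>At a fixed point the preceding estimate has \<open>D (x - xs)\<close> on both sides and
  is solved for it.\<close>

lemma fixed_point_near_equilibrium:
  assumes "x \<in> profiles G" "Tjoint G x = x" "xs \<in> equilibria G"
  shows "D (x - xs) \<le> b / (1 - \<alpha>)"
  using equilibrium_distance[OF assms(1,3)] assms(2) alpha by (simp add: field_simps)

text \<open>Both equilibria are displaced by at most \<open>b\<close>, hence the factor 2. This
  keeps the supremum in the iteration bound finite.\<close>

lemma equilibria_spread:
  assumes "xs \<in> equilibria G" "zs \<in> equilibria G"
  shows "D (xs - zs) \<le> 2 * b / (1 - \<alpha>)"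
proof -
  have "D (xs - zs) \<le> D (xs - Tjoint G xs) + D (Tjoint G xs - zs)" by (rule D_triangle_diff)
  also have "\<dots> \<le> b + (\<alpha> * D (xs - zs) + b)"
    using equilibrium_displacement[OF assms(1)] equilibrium_distance[of xs zs] assms
      equilibria_subset_profiles D_minus_commute[of xs "Tjoint G xs"] by auto
  finally show ?thesis using alpha by (simp add: field_simps)
qed

text \<open>A supremum of reals dominates its elements only if the set is bounded above; the spread
  of the equilibria around \<open>xs\<close> ensures this.\<close>

lemma equilibrium_distance_le_SUP:
  assumes "xs \<in> equilibria G"
  shows "w \<nu> * nrm \<nu> (block G \<nu> x0 - block G \<nu> xs)
    \<le> (SUP (z, \<nu>) \<in> equilibria G \<times> UNIV. w \<nu> * nrm \<nu> (block G \<nu> x0 - block G \<nu> z))"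
proof -
  have "bdd_above ((\<lambda>(z, \<nu>). w \<nu> * nrm \<nu> (block G \<nu> x0 - block G \<nu> z)) ` (equilibria G \<times> UNIV))"
  proof (rule bdd_aboveI2, clarify)
    fix z \<mu> assume "z \<in> equilibria G"
    then show "w \<mu> * nrm \<mu> (block G \<mu> x0 - block G \<mu> z) \<le> D (x0 - xs) + 2 * b / (1 - \<alpha>)"
      using component_le_D[of \<mu> "x0 - z"] D_triangle_diff[of x0 z xs] equilibria_spread[OF assms, of z]
      by (simp add: block_diff)
  qed
  from cSUP_upper[OF _ this, of "(xs, \<nu>)"] assms show ?thesis by simp
qed

section \<open>Existence of a fixed point of the best-response map\<close>

lemma closed_profiles: "closed (profiles G)"
proof -
  have "closed (block G \<nu> -` strat G \<nu>)" for \<nu>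
    using nep linear_continuous_at[OF linear_conv_bounded_linear[THEN iffD1, OF linear_block]]
    by (intro continuous_closed_vimage) (auto simp: mi_nep_def)
  moreover have "profiles G = (\<Inter>\<nu>. block G \<nu> -` strat G \<nu>)" by (auto simp: profiles_def)
  ultimately show ?thesis by auto
qed

text \<open>Banach's theorem needs a contraction in the Euclidean norm; norm equivalence makes some
  power of the best-response map one, and the fixed point of that power is inherited.\<close>

lemma Tjoint_fixed_point:
  assumes "x0 \<in> profiles G"
  obtains xb where "xb \<in> profiles G" "Tjoint G xb = xb"
proof -
  define T where "T = Tjoint G"
  obtain K L where KL: "0 < K" "0 < L" "\<And>v. norm v \<le> K * D v" "\<And>v. D v \<le> L * norm v"
    by (rule norm_on_UNIV_equivalent[OF D_norm]) (rule that, assumption+)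
  have pow: "(T ^^ n) z \<in> profiles G" if "z \<in> profiles G" for n z
    using that by (induction n) (auto simp: T_def Tjoint_in_profiles)
  have powD: "D ((T ^^ n) z - (T ^^ n) y) \<le> \<alpha> ^ n * D (z - y)"
    if "z \<in> profiles G" "y \<in> profiles G" for n z y
  proof (induction n)
    case (Suc n)
    have "D ((T ^^ Suc n) z - (T ^^ Suc n) y) \<le> \<alpha> * D ((T ^^ n) z - (T ^^ n) y)"
      using Tjoint_contraction[OF pow[OF that(1)] pow[OF that(2)], of n n] by (simp add: T_def)
    also have "\<dots> \<le> \<alpha> * (\<alpha> ^ n * D (z - y))" by (intro mult_left_mono Suc.IH alpha)
    finally show ?case by (simp add: mult.assoc)
  qed simp
  \<comment> \<open>Passing between the two norms costs a factor \<open>K * L\<close>, so this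
    \<open>n\<close> makes \<open>T ^^ n\<close> a Euclidean contraction with constant 1/2.\<close>
  obtain n where n: "\<alpha> ^ n < 1 / (2 * (K * L))"
    using real_arch_pow_inv[of "1 / (2 * (K * L))" \<alpha>] alpha KL by auto
  have "\<exists>!z\<in>profiles G. (T ^^ n) z = z"
  proof (rule Banach_fix[where c = "1/2"])
    show "complete (profiles G)" by (simp add: closed_profiles complete_eq_closed)
    show "profiles G \<noteq> {}" using assms by auto
    show "(T ^^ n) ` profiles G \<subseteq> profiles G" using pow by auto
    fix z y assume zy: "z \<in> profiles G" "y \<in> profiles G"
    have "dist ((T ^^ n) z) ((T ^^ n) y) \<le> K * (\<alpha> ^ n * (L * norm (z - y)))"
      unfolding dist_norm using KL alpha
      by (intro order_trans[OF KL(3)] mult_left_mono order_trans[OF powD[OF zy]]) auto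
    also have "\<dots> = \<alpha> ^ n * (K * L) * norm (z - y)" by simp
    also have "\<dots> \<le> 1/2 * norm (z - y)"
      using n KL by (intro mult_right_mono) (auto simp: field_simps)
    finally show "dist ((T ^^ n) z) ((T ^^ n) y) \<le> 1/2 * dist z y" by (simp add: dist_norm)
  qed auto
  then obtain z where z: "z \<in> profiles G" "(T ^^ n) z = z"
    and uniq: "\<And>y. y \<in> profiles G \<Longrightarrow> (T ^^ n) y = y \<Longrightarrow> y = z"
    by blast
  \<comment> \<open>\<open>T\<close> commutes with its powers, so \<open>T z\<close> is again a
    fixed point of \<open>T ^^ n\<close>; uniqueness identifies it with \<open>z\<close>.\<close>
  have "T z = z"
    using uniq[of "T z"] z Tjoint_in_profiles[of z] funpow_swap1[of T n z] by (simp add: T_def)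
  then show thesis using that z(1) by (simp add: T_def)
qed

section \<open>Error bounds and convergence of the Jacobi iterates\<close>

context
  fixes J :: "nat \<Rightarrow> 'p set" and x :: "nat \<Rightarrow> real ^ 'c" and h :: nat
  assumes seq: "jacobi_sequence G J x"
    and h: "1 \<le> h"
    and cover: "\<And>\<nu> k. \<nu> \<in> (\<Union>t\<in>{k..k + h - 1}. J t)"
begin

lemma jacobi_in_profiles: "x k \<in> profiles G"
proof (induction k)
  case 0
  then show ?case using seq by (simp add: jacobi_sequence_def)
next
  case (Suc k)
  then show ?case
    using seq Tmap_in_strat[OF Suc] by (auto simp: jacobi_sequence_def profiles_def)
qed

text \<open>The point \<open>p\<close> and the slack \<open>e\<close> are left open for two uses: an
  equilibrium with \<open>e = b\<close>, and a fixed point with \<open>e = 0\<close>.\<close>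

lemma jacobi_distance_bound:
  fixes M :: "nat \<Rightarrow> real"
  assumes attract: "\<And>z. z \<in> profiles G \<Longrightarrow> D (Tjoint G z - p) \<le> \<alpha> * D (z - p) + e"
    and start: "D (x 0 - p) \<le> M 0"
    and next_le: "\<And>i. i < m \<Longrightarrow> \<alpha> * M i + e \<le> M (Suc i)"
    and le: "\<And>i. i \<le> m \<Longrightarrow> \<alpha> * M i + e \<le> M i"
    and k: "h * m \<le> k"
  shows "D (x k - p) \<le> M m"
proof -
  define d where "d k \<nu> = w \<nu> * nrm \<nu> (block G \<nu> (x k - p))" for k \<nu>
  have "d k \<nu> \<le> M m" for \<nu>
  proof (rule iterated_windowed_contraction[where d = d and J = J and h = h and \<alpha> = \<alpha> and b = e
        and M = M and m = m and i = m and k = k])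
    fix k \<nu> N assume "\<nu> \<in> J k" and N: "\<And>\<mu>. d k \<mu> \<le> N"
    \<comment> \<open>The new block of an active player agrees with that of
      \<open>Tjoint G (x k)\<close>, so the estimate for the full map bounds its error.\<close>
    then have "block G \<nu> (x (Suc k) - p) = block G \<nu> (Tjoint G (x k) - p)"
      using seq by (simp add: jacobi_sequence_def block_diff block_Tjoint jacobi_in_profiles)
    then have "d (Suc k) \<nu> \<le> \<alpha> * D (x k - p) + e"
      using component_le_D[of \<nu> "Tjoint G (x k) - p"] attract[OF jacobi_in_profiles, of k]
      by (simp add: d_def)
    moreover have "\<alpha> * D (x k - p) \<le> \<alpha> * N"
      using N alpha by (intro mult_left_mono) (auto simp: d_def D_le_iff)
    ultimately show "d (Suc k) \<nu> \<le> \<alpha> * N + e" by linarith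
  next
    fix k \<nu> assume "\<nu> \<notin> J k"
    then show "d (Suc k) \<nu> = d k \<nu>"
      using seq by (simp add: jacobi_sequence_def d_def block_diff)
  next
    show "d 0 \<nu> \<le> M 0" for \<nu> using start by (simp add: d_def D_le_iff)
  qed (use cover h next_le le k in auto)
  then show ?thesis by (simp add: D_le_iff d_def)
qed

lemma jacobi_eventually_near_equilibrium:
  assumes int: "0 < (MAX \<nu>. sqrt (nint G \<nu>))"
    and gamma: "1 < \<gamma>" "\<alpha> \<noteq> 0 \<longrightarrow> \<gamma> < 1 / \<alpha>"
    and xs: "xs \<in> equilibria G"
    and k: "iteration_bound G nrm \<alpha> w \<beta> h (x 0) \<gamma> \<le> k"
  shows "D (x k - xs) < \<gamma> * (b / (1 - \<gamma> * \<alpha>))"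
proof -
  define C where "C = b / (1 - \<gamma> * \<alpha>)"
  define S where
    "S = (SUP (z, \<nu>) \<in> equilibria G \<times> UNIV. w \<nu> * nrm \<nu> (block G \<nu> (x 0) - block G \<nu> z))"
  \<comment> \<open>\<open>h * m\<close> is the iteration bound; the maximum with
    \<open>\<gamma>\<close> makes the logarithm at least 1.\<close>
  define m where "m = nat \<lceil>log \<gamma> (max ((1 - \<gamma> * \<alpha>) * S / b) \<gamma>)\<rceil>"
  \<comment> \<open>For \<open>\<alpha> = 0\<close> the product vanishes, in line with the
    convention that \<open>1 / \<alpha>\<close> is then infinite.\<close>
  have ga: "\<gamma> * \<alpha> < 1" using gamma alpha by (cases "\<alpha> = 0") (auto simp: field_simps)
  obtain \<nu> where "0 < sqrt (nint G \<nu>)" using int by (auto simp: Max_gr_iff)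
  then have "0 < w \<nu> * sqrt (nint G \<nu>)" using w_pos by simp
  then have "0 < (MAX \<nu>. w \<nu> * sqrt (nint G \<nu>))" by (subst Max_gr_iff) (simp_all, blast)
  then have b: "0 < b" unfolding b_def by (rule mult_pos_pos[OF beta])
  have C: "0 < C" "(1 - \<gamma> * \<alpha>) * C = b" using ga b by (simp_all add: C_def)
  have "max ((1 - \<gamma> * \<alpha>) * S / b) \<gamma> \<le> \<gamma> powr m"
    using gamma by (subst log_le_iff[symmetric]) (auto simp: m_def intro!: of_nat_ceiling)
  then have "(1 - \<gamma> * \<alpha>) * S / b \<le> \<gamma> ^ m" using gamma by (simp add: powr_realpow)
  then have S: "S \<le> \<gamma> ^ m * C" using ga b by (simp add: C_def field_simps)
  \<comment> \<open>The right side minus the left side equals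
    \<open>(\<gamma> ^ i - 1) * b\<close>.\<close>
  have rec: "\<alpha> * (\<gamma> ^ Suc i * C) + b \<le> \<gamma> ^ i * C" for i
  proof -
    have "0 \<le> (\<gamma> ^ i - 1) * ((1 - \<gamma> * \<alpha>) * C)"
      using gamma C b ga by (intro mult_nonneg_nonneg) auto
    then show ?thesis using C by (simp add: algebra_simps)
  qed
  \<comment> \<open>The levels \<open>\<gamma> ^ (m - i) * C\<close> descend from a bound on the
    initial error to \<open>C\<close>; the exponent \<open>m - m\<close> is kept to match the last
    level \<open>M m\<close>.\<close>
  have "D (x k - xs) \<le> \<gamma> ^ (m - m) * C"
  proof (rule jacobi_distance_bound[where M = "\<lambda>i. \<gamma> ^ (m - i) * C" and e = b])
    show "D (Tjoint G z - xs) \<le> \<alpha> * D (z - xs) + b" if "z \<in> profiles G" for z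
      using that xs by (rule equilibrium_distance)
    have "D (x 0 - xs) \<le> S"
      using equilibrium_distance_le_SUP[OF xs, of _ "x 0"] by (simp add: D_le_iff block_diff S_def)
    then show "D (x 0 - xs) \<le> \<gamma> ^ (m - 0) * C" using S by simp
    show "\<alpha> * (\<gamma> ^ (m - i) * C) + b \<le> \<gamma> ^ (m - Suc i) * C" if "i < m" for i
      using rec[of "m - Suc i"] that by (simp add: Suc_diff_Suc del: power_Suc)
    show "\<alpha> * (\<gamma> ^ (m - i) * C) + b \<le> \<gamma> ^ (m - i) * C" for i
    proof -
      \<comment> \<open>Raising the exponent enlarges the left side, so \<open>rec\<close> also
        shows that no level is raised.\<close>
      have "\<alpha> * (\<gamma> ^ (m - i) * C) \<le> \<alpha> * (\<gamma> ^ Suc (m - i) * C)"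
        using gamma alpha C by (intro mult_left_mono mult_right_mono power_increasing) auto
      then show ?thesis using rec[of "m - i"] by linarith
    qed
    show "h * m \<le> k" using k by (simp add: iteration_bound_def m_def S_def b_def)
  qed
  then have "D (x k - xs) \<le> C" by simp
  also have "C < \<gamma> * C" using gamma C by simp
  finally show ?thesis by (simp add: C_def)
qed

text \<open>Relative to a fixed point there is no slack, so \<open>m\<close> windows shrink the
  error bound by \<open>\<alpha> ^ m\<close>; norm equivalence transfers the decay to the Euclidean
  norm.\<close>

lemma jacobi_tendsto_fixed_point:
  assumes "xb \<in> profiles G" "Tjoint G xb = xb"
  shows "x \<longlonglongrightarrow> xb"
proof -
  obtain K where K: "0 < K" "\<And>v. norm v \<le> K * D v"
    by (rule norm_on_UNIV_equivalent[OF D_norm]) (rule that, assumption+)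
  define c where "c = D (x 0 - xb)"
  have c: "0 \<le> c" by (simp add: c_def D_nonneg)
  have bound: "D (x k - xb) \<le> \<alpha> ^ m * c" if "h * m \<le> k" for k m
  proof (rule jacobi_distance_bound[where M = "\<lambda>i. \<alpha> ^ i * c" and e = 0])
    show "D (Tjoint G z - xb) \<le> \<alpha> * D (z - xb) + 0" if "z \<in> profiles G" for z
      using Tjoint_contraction[OF that assms(1)] assms(2) by simp
    show "\<alpha> * (\<alpha> ^ i * c) + 0 \<le> \<alpha> ^ i * c" for i
      using mult_right_mono[of \<alpha> 1 "\<alpha> ^ i * c"] alpha c by simp
  qed (use that in \<open>simp_all add: c_def\<close>)
  show ?thesis
  proof (rule LIMSEQ_I)
    fix r :: real assume r: "0 < r"
    \<comment> \<open>Using \<open>c + 1\<close> instead of \<open>c\<close> avoids a zero divisor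
      when the sequence starts at the fixed point.\<close>
    obtain m where "\<alpha> ^ m < r / (K * (c + 1))"
      using real_arch_pow_inv[of "r / (K * (c + 1))" \<alpha>] alpha K r c by auto
    moreover have "0 < K * (c + 1)" using K c by simp
    ultimately have m: "K * (\<alpha> ^ m * (c + 1)) < r"
      by (simp only: pos_less_divide_eq mult.left_commute)
    have "norm (x k - xb) < r" if "h * m \<le> k" for k
    proof -
      have "norm (x k - xb) \<le> K * (\<alpha> ^ m * c)"
        using K bound[OF that] by (intro order_trans[OF K(2)] mult_left_mono) auto
      also have "\<dots> \<le> K * (\<alpha> ^ m * (c + 1))"
        using K alpha by (intro mult_left_mono) auto
      finally show ?thesis using m by simp
    qed
    then show "\<exists>n0. \<forall>k\<ge>n0. norm (x k - xb) < r" by blast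
  qed
qed

end

end

theorem theorem3:
  fixes G :: "('p::finite, 'c::finite) game"
    and nrm :: "'p \<Rightarrow> real ^ 'c \<Rightarrow> real"
    and \<alpha> \<beta> :: real and w :: "'p \<Rightarrow> real"
    and J :: "nat \<Rightarrow> 'p set" and x :: "nat \<Rightarrow> real ^ 'c" and h :: nat
  assumes "mi_nep G"
    and "single_valued_cont_best G"
    and "\<forall>\<nu>. is_norm_on (pspace G \<nu>) (nrm \<nu>)"
    and "assumption_A G nrm \<alpha> w"
    and "assumption_B G nrm \<beta>"
    and "(MAX \<nu>. sqrt (nint G \<nu>)) > 0"
    and "jacobi_sequence G J x"
    and "h \<ge> 1"
    and "\<forall>\<nu> k. \<nu> \<in> (\<Union>t\<in>{k..k + h - 1}. J t)"
  shows
    "(\<forall>\<gamma> xs. 1 < \<gamma> \<and> (\<alpha> \<noteq> 0 \<longrightarrow> \<gamma> < 1 / \<alpha>) \<and> xs \<in> equilibria G \<longrightarrow>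
        (\<exists>k \<le> iteration_bound G nrm \<alpha> w \<beta> h (x 0) \<gamma>.
           (MAX \<nu>. w \<nu> * nrm \<nu> (block G \<nu> (x k) - block G \<nu> xs))
             < \<beta> * (\<gamma> / (1 - \<gamma> * \<alpha>)) * (MAX \<nu>. w \<nu> * sqrt (nint G \<nu>)))) \<and>
     (\<forall>\<gamma> xs. 1 < \<gamma> \<and> (\<alpha> \<noteq> 0 \<longrightarrow> \<gamma> < 1 / \<alpha>) \<and> xs \<in> equilibria G \<longrightarrow>
        (\<forall>k \<ge> iteration_bound G nrm \<alpha> w \<beta> h (x 0) \<gamma>.
           (MAX \<nu>. w \<nu> * nrm \<nu> (block G \<nu> (x k) - block G \<nu> xs))
             < \<beta> * (\<gamma> / (1 - \<gamma> * \<alpha>)) * (MAX \<nu>. w \<nu> * sqrt (nint G \<nu>)))) \<and>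
     (\<exists>xb\<in>profiles G. x \<longlonglongrightarrow> xb \<and> (\<forall>y. x \<longlonglongrightarrow> y \<longrightarrow> y = xb) \<and>
        (\<forall>xs\<in>equilibria G.
           (MAX \<nu>. w \<nu> * nrm \<nu> (block G \<nu> xb - block G \<nu> xs))
             \<le> \<beta> * (1 / (1 - \<alpha>)) * (MAX \<nu>. w \<nu> * sqrt (nint G \<nu>))))"
proof -
  interpret contractive_mi_nep G nrm \<alpha> \<beta> w
    using assms by unfold_locales auto
  note jac = assms(7,8) assms(9)[rule_format]
  \<comment> \<open>This is claim (ii); claim (i) is its instance with \<open>k\<close> equal to the
    iteration bound.\<close>
  have near: "(MAX \<nu>. w \<nu> * nrm \<nu> (block G \<nu> (x k) - block G \<nu> xs))
      < \<beta> * (\<gamma> / (1 - \<gamma> * \<alpha>)) * (MAX \<nu>. w \<nu> * sqrt (nint G \<nu>))"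
    if "1 < \<gamma>" "\<alpha> \<noteq> 0 \<longrightarrow> \<gamma> < 1 / \<alpha>" "xs \<in> equilibria G"
      "iteration_bound G nrm \<alpha> w \<beta> h (x 0) \<gamma> \<le> k" for \<gamma> xs k
    using jacobi_eventually_near_equilibrium[OF jac assms(6) that]
    by (simp add: D_diff b_def mult_ac)
  obtain xb where xb: "xb \<in> profiles G" "Tjoint G xb = xb"
    using Tjoint_fixed_point[OF jacobi_in_profiles[OF jac]] by blast
  have lim: "x \<longlonglongrightarrow> xb" by (rule jacobi_tendsto_fixed_point[OF jac xb])
  have "(MAX \<nu>. w \<nu> * nrm \<nu> (block G \<nu> xb - block G \<nu> xs))
      \<le> \<beta> * (1 / (1 - \<alpha>)) * (MAX \<nu>. w \<nu> * sqrt (nint G \<nu>))" if "xs \<in> equilibria G" for xs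
    using fixed_point_near_equilibrium[OF xb that] by (simp add: D_diff b_def)
  moreover have "y = xb" if "x \<longlonglongrightarrow> y" for y using LIMSEQ_unique[OF that lim] .
  ultimately show ?thesis using near lim xb(1) by blast
qed

end
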